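(* Computing a connected $\epsilon$-equitable allocation for two players requires $\Omega(\log\frac1\epsilon)$ queries in the Robertson–Webb (RW) model. That is, there are constants $c>0$ and $\epsilon_0\in(0,1)$ such that for every $0<\epsilon<\epsilon_0$, every deterministic RW protocol that outputs a connected $\epsilon$-equitable allocation for every choice of value densities $v_1,v_2$ asks at least $c\log\frac1\epsilon$ queries on some instance.
   Context: Cake cutting model. The cake is $[0,1]$ and the players are $N=\{1,\dots,n\}$ (here $n=2$). Player $i$ has a private non-negative integrable value density $v_i$ on $[0,1]$ with $\int_0^1 v_i=1$, and values a measurable set $S$ at $V_i(S)=\int_S v_i(x)\,dx$. A piece is a finite union of disjoint intervals (shared endpoints are irrelevant, since sets of measure zero are worth zero); it is connected if it is a single interval. An allocation $A=(A_1,\dots,A_n)$ is a partition of $[0,1]$ into pieces, player $i$ receiving $A_i$. It is connected if every $A_i$ is connected, and $\epsilon$-equitable if $|V_i(A_i)-V_j(A_j)|\le\epsilon$ for all $i,j$. RW model. A protocol, not knowing the densities, adaptively asks the players queries of two types: $\mathrm{Cut}_i(\alpha)$, for any $\alpha\in[0,1]$: player $i$ returns a point $y$ with $V_i([0,y])=\alpha$ (ties resolved deterministically, e.g. the leftmost such point), and $y$ becomes a cut point; $\mathrm{Eval}_i(y)$, for a previously made cut point $y$: player $i$ returns $V_i([0,y])$. At the end the protocol outputs an allocation demarcated by cut points discovered through its queries. Protocols are deterministic and the number of queries is counted in the worst case over instances. *)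

theory Defs
  imports "HOL-Analysis.Analysis"
begin

text \<open>Cake, valuations and allocations. The players are \<open>1, \<dots>, n\<close>; values of a profile or of an
  allocation at other indices are irrelevant.\<close>

definition value_density :: "(real \<Rightarrow> real) \<Rightarrow> bool" where
  "value_density v \<longleftrightarrow> set_integrable lebesgue {0..1} v \<and> (\<forall>x\<in>{0..1}. 0 \<le> v x)
     \<and> (LINT x:{0..1}|lebesgue. v x) = 1"

definition cake_value :: "(real \<Rightarrow> real) \<Rightarrow> real set \<Rightarrow> real" where
  "cake_value v S = (LINT x:S|lebesgue. v x)"

definition cake_instance :: "nat \<Rightarrow> (nat \<Rightarrow> real \<Rightarrow> real) \<Rightarrow> bool" where
  "cake_instance n v \<longleftrightarrow> (\<forall>i\<in>{1..n}. value_density (v i))"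

definition piece :: "real set \<Rightarrow> bool" where
  "piece S \<longleftrightarrow> S \<subseteq> {0..1} \<and>
     (\<exists>\<C>. finite \<C> \<and> disjoint \<C> \<and> (\<forall>I\<in>\<C>. is_interval I) \<and> S = \<Union>\<C>)"

text \<open>Pieces of different players may overlap in finitely many points, so that both closed intervals
  with shared endpoints and genuine set-theoretic partitions are admitted.\<close>

definition allocation :: "nat \<Rightarrow> (nat \<Rightarrow> real set) \<Rightarrow> bool" where
  "allocation n A \<longleftrightarrow> (\<forall>i\<in>{1..n}. piece (A i)) \<and> (\<Union>i\<in>{1..n}. A i) = {0..1}
     \<and> (\<forall>i\<in>{1..n}. \<forall>j\<in>{1..n}. i \<noteq> j \<longrightarrow> finite (A i \<inter> A j))"

definition connected_allocation :: "nat \<Rightarrow> (nat \<Rightarrow> real set) \<Rightarrow> bool" where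
  "connected_allocation n A \<longleftrightarrow> allocation n A \<and> (\<forall>i\<in>{1..n}. is_interval (A i))"

definition equitable :: "real \<Rightarrow> nat \<Rightarrow> (nat \<Rightarrow> real \<Rightarrow> real) \<Rightarrow> (nat \<Rightarrow> real set) \<Rightarrow> bool" where
  "equitable \<epsilon> n v A \<longleftrightarrow>
     (\<forall>i\<in>{1..n}. \<forall>j\<in>{1..n}. \<bar>cake_value (v i) (A i) - cake_value (v j) (A j)\<bar> \<le> \<epsilon>)"


text \<open>The Robertson--Webb model. A deterministic protocol chooses its next action from the
  transcript (oldest entry first) of the queries asked so far and their answers, and from nothing
  else. It is not required a priori to stop.\<close>

datatype query = Cut nat real | Eval nat real

type_synonym transcript = "(query \<times> real) list"

datatype action = Ask query | Return "nat \<Rightarrow> real set"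

type_synonym protocol = "transcript \<Rightarrow> action"

definition cut_points :: "transcript \<Rightarrow> real set" where
  "cut_points h = {y. \<exists>i \<alpha>. (Cut i \<alpha>, y) \<in> set h}"

fun legal_query :: "nat \<Rightarrow> transcript \<Rightarrow> query \<Rightarrow> bool" where
  "legal_query n h (Cut i \<alpha>) \<longleftrightarrow> i \<in> {1..n} \<and> \<alpha> \<in> {0..1}"
| "legal_query n h (Eval i y) \<longleftrightarrow> i \<in> {1..n} \<and> y \<in> cut_points h"

text \<open>A cut rule resolves ties deterministically: \<open>\<rho> i v \<alpha>\<close> is the answer of player \<open>i\<close>, with
  density \<open>v\<close>, to the query \<open>Cut i \<alpha>\<close>. The leftmost admissible point is one such rule (lemma
  \<open>cut_rule_leftmost\<close>).\<close>

definition cut_rule :: "(nat \<Rightarrow> (real \<Rightarrow> real) \<Rightarrow> real \<Rightarrow> real) \<Rightarrow> bool" where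
  "cut_rule \<rho> \<longleftrightarrow> (\<forall>i v \<alpha>. value_density v \<longrightarrow> \<alpha> \<in> {0..1} \<longrightarrow>
     \<rho> i v \<alpha> \<in> {0..1} \<and> cake_value v {0..\<rho> i v \<alpha>} = \<alpha>)"

fun answer :: "(nat \<Rightarrow> (real \<Rightarrow> real) \<Rightarrow> real \<Rightarrow> real) \<Rightarrow> (nat \<Rightarrow> real \<Rightarrow> real) \<Rightarrow> query \<Rightarrow> real" where
  "answer \<rho> v (Cut i \<alpha>) = \<rho> i (v i) \<alpha>"
| "answer \<rho> v (Eval i y) = cake_value (v i) {0..y}"

text \<open>The transcripts that occur while \<open>P\<close> is executed on \<open>v\<close>. An illegal query blocks the execution,
  so a protocol asking one on an instance outputs nothing on that instance.\<close>

inductive run :: "nat \<Rightarrow> (nat \<Rightarrow> (real \<Rightarrow> real) \<Rightarrow> real \<Rightarrow> real) \<Rightarrow> protocol \<Rightarrow> (nat \<Rightarrow> real \<Rightarrow> real)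
    \<Rightarrow> transcript \<Rightarrow> bool"
  for n \<rho> P v where
  start: "run n \<rho> P v []"
| ask: "run n \<rho> P v h \<Longrightarrow> P h = Ask q \<Longrightarrow> legal_query n h q \<Longrightarrow>
    run n \<rho> P v (h @ [(q, answer \<rho> v q)])"

text \<open>The output must be demarcated by the discovered cut points and the two ends of the cake; the
  endpoints of the maximal intervals of a piece form its frontier.\<close>

definition outputs :: "nat \<Rightarrow> (nat \<Rightarrow> (real \<Rightarrow> real) \<Rightarrow> real \<Rightarrow> real) \<Rightarrow> protocol \<Rightarrow> (nat \<Rightarrow> real \<Rightarrow> real)
    \<Rightarrow> transcript \<Rightarrow> (nat \<Rightarrow> real set) \<Rightarrow> bool" where
  "outputs n \<rho> P v h A \<longleftrightarrow> run n \<rho> P v h \<and> P h = Return A \<and> allocation n A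
     \<and> (\<forall>i\<in>{1..n}. frontier (A i) \<subseteq> cut_points h \<union> {0, 1})"

definition computes_connected_equitable ::
  "real \<Rightarrow> nat \<Rightarrow> (nat \<Rightarrow> (real \<Rightarrow> real) \<Rightarrow> real \<Rightarrow> real) \<Rightarrow> protocol \<Rightarrow> bool" where
  "computes_connected_equitable \<epsilon> n \<rho> P \<longleftrightarrow> (\<forall>v. cake_instance n v \<longrightarrow>
     (\<exists>h A. outputs n \<rho> P v h A \<and> connected_allocation n A \<and> equitable \<epsilon> n v A))"


definition leftmost :: "nat \<Rightarrow> (real \<Rightarrow> real) \<Rightarrow> real \<Rightarrow> real" where
  "leftmost i v \<alpha> = Inf {y \<in> {0..1}. cake_value v {0..y} = \<alpha>}"

lemma cut_rule_leftmost: "cut_rule leftmost"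
  unfolding cut_rule_def
proof (intro allI impI)
  fix i :: nat and v \<alpha> assume v: "value_density v" and a: "\<alpha> \<in> {0..1::real}"
  define F where "F y = cake_value v {0..y}" for y
  have abs: "v absolutely_integrable_on {0..1}"
    using v by (simp add: value_density_def)
  have F: "F y = integral {0..y} v" if "y \<in> {0..1}" for y
  proof -
    have "v absolutely_integrable_on {0..y}"
      using that by (intro set_integrable_subset[OF abs]) auto
    then show ?thesis
      by (simp add: F_def cake_value_def set_lebesgue_integral_eq_integral)
  qed
  have "v integrable_on {0..1}"
    using abs by (rule set_lebesgue_integral_eq_integral)
  then have "continuous_on {0..1} (\<lambda>y. integral {0..y} v)"
    by (rule indefinite_integral_continuous_1)
  then have cont: "continuous_on {0..1} F"
    by (rule continuous_on_eq) (simp add: F)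
  have "F 0 = 0" "F 1 = 1"
    using v F[of 0] by (auto simp: F_def cake_value_def value_density_def)
  then obtain y where y: "0 \<le> y" "y \<le> 1" "F y = \<alpha>"
    using IVT'[of F 0 \<alpha> 1] cont a by auto
  define S where "S = {y \<in> {0..1}. F y = \<alpha>}"
  have "closed S"
    unfolding S_def using continuous_closed_preimage_constant[OF cont] by simp
  moreover have "S \<noteq> {}" "bdd_below S"
    using y by (auto simp: S_def)
  ultimately have "Inf S \<in> S"
    by (intro closed_contains_Inf) auto
  moreover have "leftmost i v \<alpha> = Inf S"
    by (simp add: leftmost_def S_def F_def)
  ultimately show "leftmost i v \<alpha> \<in> {0..1} \<and> cake_value v {0..leftmost i v \<alpha>} = \<alpha>"
    by (simp add: S_def F_def)
qed

end

theory Submission imports Defs begin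

text \<open>An adversary argument. Player 1 has the uniform density, so that with \<open>F\<close> the distribution
  function of player 2 a cut at \<open>x\<close> is \<open>\<epsilon>\<close>-equitable iff \<open>\<bar>x + F x - 1\<bar> \<le> \<epsilon>\<close>, whichever player gets
  the left part. The adversary keeps a window \<open>(p, p + L)\<close> that contains no cut point and that \<open>F\<close>
  maps onto \<open>(1 - p - L, 1 - p)\<close>; by monotonicity \<open>\<bar>x + F x - 1\<bar> \<ge> L\<close> for every \<open>x\<close> outside it, and
  nothing about \<open>F\<close> inside it has been revealed. A cut query inside the window is answered by fixing
  \<open>F\<close> so that a window of the same shape and of length \<open>L / 4\<close> survives in the first or in the
  second half. Hence after \<open>k\<close> queries \<open>L \<ge> 4\<^sup>-\<^sup>k\<close>, and no output is possible while \<open>L > \<epsilon>\<close>.\<close>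

section \<open>Distribution functions, windows and their densities\<close>

definition cdf :: "(real \<Rightarrow> real) \<Rightarrow> real \<Rightarrow> real" where
  "cdf v x = cake_value v {0..x}"

text \<open>A uniform lower bound, rather than mere positivity, makes strict growth of
  \<open>cdf v\<close> an immediate estimate and survives the later perturbations with a smaller
  \<open>\<delta>\<close>.\<close>

definition positive_density :: "(real \<Rightarrow> real) \<Rightarrow> bool" where
  "positive_density v \<longleftrightarrow> value_density v \<and> (\<exists>\<delta>>0. \<forall>x\<in>{0..1}. \<delta> \<le> v x)"

definition profile :: "(real \<Rightarrow> real) \<Rightarrow> nat \<Rightarrow> real \<Rightarrow> real" where
  "profile v = (\<lambda>i. if i = 1 then (\<lambda>_. 1) else v)"

text \<open>Agreement is asked of distribution functions, since they determine the answers to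
  queries. The excluded interval is open, so a window inside the cake has the same mass under both
  densities.\<close>

definition agree_outside :: "real \<Rightarrow> real \<Rightarrow> (real \<Rightarrow> real) \<Rightarrow> (real \<Rightarrow> real) \<Rightarrow> bool" where
  "agree_outside p L v w \<longleftrightarrow> (\<forall>x\<in>{0..1} - {p<..<p + L}. cdf w x = cdf v x)"

text \<open>The last equation lets \<open>cdf v\<close> run over the window with slope 1 from
  \<open>1 - p - L\<close> to \<open>1 - p\<close>; exact balance \<open>x + cdf v x = 1\<close>
  then occurs at the midpoint. Density 1 leaves room for the next perturbation.\<close>

definition window :: "real \<Rightarrow> real \<Rightarrow> (real \<Rightarrow> real) \<Rightarrow> bool" where
  "window p L v \<longleftrightarrow> positive_density v \<and> 0 \<le> p \<and> 0 < L \<and> p + L \<le> 1 \<and>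
     (\<forall>x\<in>{p..p + L}. v x = 1 \<and> cdf v x = 1 - 2 * p - L + x)"

section \<open>Executions of a deterministic protocol\<close>

lemma run_prefix: "run n \<rho> P v (h @ t) \<Longrightarrow> run n \<rho> P v h"
proof (induction t rule: rev_induct)
  case (snoc e t)
  from snoc.prems have "run n \<rho> P v (h @ t)"
    by (cases rule: run.cases) auto
  then show ?case by (rule snoc.IH)
qed simp

lemma run_snocD:
  assumes "run n \<rho> P v (h @ [e])"
  obtains q where "P h = Ask q" "legal_query n h q" "e = (q, answer \<rho> v q)"
  using assms by (cases rule: run.cases) auto

text \<open>Protocol and instance determine every step, so all transcripts lie on one chain; nothing
  follows a \<open>Return\<close>, so \<open>h'\<close> is its end.\<close>

lemma run_extends:
  assumes "run n \<rho> P v h" "run n \<rho> P v h'" "P h' = Return A"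
  shows "\<exists>t. h' = h @ t"
  using assms(1)
proof induction
  case (ask h q)
  then obtain t where t: "h' = h @ t" by blast
  with ask.hyps(2) assms(3) have "t \<noteq> []" by auto
  then obtain e t' where t': "t = e # t'" by (cases t) auto
  have "run n \<rho> P v (h @ [e])"
    using assms(2) run_prefix[of n \<rho> P v "h @ [e]" t'] by (simp add: t t')
  then have "e = (q, answer \<rho> v q)"
    by (rule run_snocD) (use ask.hyps(2) in auto)
  then show ?case by (simp add: t t')
qed simp

text \<open>An execution known to reach an output is never blocked by an illegal query on the
  way.\<close>

lemma run_next:
  assumes "run n \<rho> P v h" "run n \<rho> P v h'" "P h' = Return A"
  obtains "h' = h" | q where "P h = Ask q" "legal_query n h q"
proof -
  obtain t where t: "h' = h @ t" using run_extends[OF assms] ..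
  show thesis
  proof (cases t)
    case (Cons e t')
    have "run n \<rho> P v (h @ [e])"
      using assms(2) run_prefix[of n \<rho> P v "h @ [e]" t'] by (simp add: t Cons)
    then obtain q where "P h = Ask q" "legal_query n h q" by (rule run_snocD)
    with that(2) show ?thesis by (simp add: t Cons)
  qed (use that(1) t in simp)
qed

section \<open>Distribution functions of densities\<close>

lemma value_density_integrable:
  "value_density v \<Longrightarrow> 0 \<le> a \<Longrightarrow> b \<le> 1 \<Longrightarrow> set_integrable lebesgue {a..b} v"
  unfolding value_density_def by (rule set_integrable_subset[of _ "{0..1}"]) auto

lemma cake_value_eq_integral:
  "set_integrable lebesgue S v \<Longrightarrow> cake_value v S = integral S v"
  by (simp add: cake_value_def set_lebesgue_integral_eq_integral)

lemma cake_value_interval: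
  assumes "value_density v" "0 \<le> a" "a \<le> b" "b \<le> 1"
  shows "cake_value v {a..b} = cdf v b - cdf v a"
proof -
  have "set_integrable lebesgue {0..b} v"
    using assms by (intro value_density_integrable) auto
  then have "v integrable_on {0..b}" by (rule set_lebesgue_integral_eq_integral)
  then have "integral {0..a} v + integral {a..b} v = integral {0..b} v"
    using assms by (intro Henstock_Kurzweil_Integration.integral_combine) auto
  then show ?thesis
    using assms by (simp add: cdf_def cake_value_eq_integral value_density_integrable)
qed

lemma cdf_bounds:
  assumes "value_density v"
  shows "cdf v 0 = 0" "cdf v 1 = 1"
  using assms cake_value_eq_integral[OF value_density_integrable[OF assms], of 0 0]
  by (auto simp: cdf_def value_density_def cake_value_def)

lemma cdf_strict_mono:
  assumes "positive_density v" "0 \<le> x" "x < y" "y \<le> 1"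
  shows "cdf v x < cdf v y"
proof -
  obtain d where d: "d > 0" "\<And>x. x \<in> {0..1} \<Longrightarrow> d \<le> v x" and v: "value_density v"
    using assms(1) by (auto simp: positive_density_def)
  have i: "set_integrable lebesgue {x..y} v"
    using assms by (intro value_density_integrable v) auto
  have "integral {x..y} (\<lambda>_. d) \<le> integral {x..y} v"
    using d assms set_lebesgue_integral_eq_integral(1)[OF i]
    by (intro integral_le) auto
  moreover have "d * (y - x) > 0" using d assms by simp
  ultimately show ?thesis
    using cake_value_interval[OF v, of x y] cake_value_eq_integral[OF i] assms
    by (simp add: mult.commute)
qed

lemma cdf_inj:
  assumes "positive_density v" "x \<in> {0..1}" "y \<in> {0..1}" "cdf v x = cdf v y"
  shows "x = y"
  using cdf_strict_mono[OF assms(1), of x y] cdf_strict_mono[OF assms(1), of y x] assms(2-4)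
  by (cases x y rule: linorder_cases) auto

text \<open>Since \<open>cdf v\<close> is injective the query has no ties, and every cut rule must
  give the same answer; this makes the lower bound independent of \<open>\<rho>\<close>.\<close>

lemma cut_rule_eqI:
  assumes "cut_rule \<rho>" "positive_density v" "x \<in> {0..1}" "\<alpha> \<in> {0..1}" "cdf v x = \<alpha>"
  shows "\<rho> i v \<alpha> = x"
proof -
  have "\<rho> i v \<alpha> \<in> {0..1}" "cdf v (\<rho> i v \<alpha>) = \<alpha>"
    using assms by (auto simp: cut_rule_def positive_density_def cdf_def)
  with assms show ?thesis by (auto intro: cdf_inj)
qed

lemma set_integral_one_interval: "0 \<le> x \<Longrightarrow> (LINT t:{0..x}|lebesgue. 1) = (x :: real)"
  by (simp add: set_lebesgue_integral_def)

lemma cdf_uniform: "0 \<le> x \<Longrightarrow> cdf (\<lambda>_. 1) x = x"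
  by (simp add: cdf_def cake_value_def set_integral_one_interval)

lemma positive_density_uniform: "positive_density (\<lambda>_. 1)"
  by (auto simp: positive_density_def value_density_def set_integrable_def set_integral_one_interval
      intro!: exI[of _ 1])

lemma cake_instance_profile: "positive_density v \<Longrightarrow> cake_instance 2 (profile v)"
  using positive_density_uniform
  by (auto simp: cake_instance_def profile_def positive_density_def)

section \<open>Perturbing a density inside a window\<close>

lemma cdf_add_bump:
  fixes v :: "real \<Rightarrow> real" and c :: real
  assumes v: "set_integrable lebesgue {0..1} v" and ab: "0 \<le> a" "a \<le> b" "b \<le> 1"
  defines "w \<equiv> \<lambda>x. v x + c * indicator {a<..<b} x"
  shows "set_integrable lebesgue {0..1} w"
    and "x \<in> {0..1} \<Longrightarrow> cdf w x = cdf v x + c * max 0 (min b x - a)"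
proof -
  have fin: "emeasure lborel ({0..y} \<inter> {a<..<b}) < \<infinity>" for y
    by (rule emeasure_bounded_finite) (rule bounded_Int, simp)
  have g: "set_integrable lebesgue {0..y} (\<lambda>x. c * indicator {a<..<b} x :: real)" for y
    unfolding set_integrable_def
    using fin by (simp add: mult.left_commute[of _ c] indicator_inter_arith[symmetric])
  show "set_integrable lebesgue {0..1} w"
    unfolding w_def by (intro set_integral_add v g)
  assume x: "x \<in> {0..1}"
  have vx: "set_integrable lebesgue {0..x} v"
    using x by (intro set_integrable_subset[OF v]) auto
  have "(LINT t:{0..x}|lebesgue. c * indicator {a<..<b} t :: real) = c * measure lebesgue ({0..x} \<inter> {a<..<b})"
    by (simp add: set_lebesgue_integral_def indicator_inter_arith[symmetric])
  moreover have "measure lebesgue ({0..x} \<inter> {a<..<b}) = max 0 (min b x - a)"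
  proof -
    consider "x \<le> a" | "a < x" "x < b" | "b \<le> x" by linarith
    then show ?thesis
    proof cases
      case 1
      then have "{0..x} \<inter> {a<..<b} = {}" by auto
      with 1 show ?thesis by simp
    next
      case 2
      then have "{0..x} \<inter> {a<..<b} = {a<..x}" using ab by auto
      with 2 show ?thesis by simp
    next
      case 3
      then have "{0..x} \<inter> {a<..<b} = {a<..<b}" using ab by auto
      with 3 ab show ?thesis by simp
    qed
  qed
  ultimately show "cdf w x = cdf v x + c * max 0 (min b x - a)"
    by (simp add: cdf_def cake_value_def w_def set_integral_add(2)[OF vx g])
qed

text \<open>The two open bumps are disjoint and \<open>v\<close> is 1 on the window, so heights of
  at least \<open>- 1 / 2\<close> keep the density at or above \<open>1 / 2\<close> there. By
  \<open>bal\<close> the added and removed masses cancel, so nothing changes to the right of the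
  window.\<close>

lemma window_bumps:
  assumes W: "window p L v"
    and ord: "p \<le> a" "a \<le> b" "b \<le> a'" "a' \<le> b'" "b' \<le> p + L"
    and c: "- 1 / 2 \<le> c" "- 1 / 2 \<le> d" and bal: "c * (b - a) + d * (b' - a') = 0"
  defines "w \<equiv> \<lambda>x. v x + c * indicator {a<..<b} x + d * indicator {a'<..<b'} x"
  shows "positive_density w"
    and "\<And>x. x \<in> {0..1} \<Longrightarrow>
      cdf w x = cdf v x + c * max 0 (min b x - a) + d * max 0 (min b' x - a')"
    and "agree_outside p L v w"
proof -
  have vi: "set_integrable lebesgue {0..1} v"
    and p: "0 \<le> p" "p + L \<le> 1" and v1: "\<And>x. x \<in> {p..p+L} \<Longrightarrow> v x = 1"
    and v: "value_density v"
    using W by (auto simp: window_def positive_density_def value_density_def)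
  define u where "u = (\<lambda>x. v x + c * indicator {a<..<b} x)"
  have u: "set_integrable lebesgue {0..1} u"
    "\<And>x. x \<in> {0..1} \<Longrightarrow> cdf u x = cdf v x + c * max 0 (min b x - a)"
    unfolding u_def using ord p by (intro cdf_add_bump[OF vi]; simp)+
  have w_u: "w = (\<lambda>x. u x + d * indicator {a'<..<b'} x)"
    by (simp add: w_def u_def)
  have wi: "set_integrable lebesgue {0..1} w"
    unfolding w_u using ord p by (intro cdf_add_bump[OF u(1)]; simp)
  show cdf_w: "cdf w x = cdf v x + c * max 0 (min b x - a) + d * max 0 (min b' x - a')"
    if "x \<in> {0..1}" for x
    unfolding w_u using ord p that u(2) by (subst cdf_add_bump(2)[OF u(1)]; simp)
  show "agree_outside p L v w"
    unfolding agree_outside_def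
  proof
    fix x assume x: "x \<in> {0..1} - {p<..<p+L}"
    then consider "x \<le> p" | "p + L \<le> x" by fastforce
    then show "cdf w x = cdf v x"
    proof cases
      case 1
      with x cdf_w[of x] ord show ?thesis by simp
    next
      case 2
      with x cdf_w[of x] ord bal show ?thesis by simp
    qed
  qed
  have "cdf w 1 = 1"
    using cdf_w[of 1] ord p bal cdf_bounds[OF v] by (auto simp: max_def min_def)
  moreover obtain e where e: "e > 0" "\<And>x. x \<in> {0..1} \<Longrightarrow> e \<le> v x"
    using W by (auto simp: window_def positive_density_def)
  moreover have lb: "min e (1/2) \<le> w x" if "x \<in> {0..1}" for x
    using e(2)[OF that] v1[of x] ord c by (auto simp: w_def indicator_def)
  moreover have e': "min e (1/2) > 0" using e(1) by simp
  moreover have "0 \<le> w x" if "x \<in> {0..1}" for x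
    using lb[OF that] e' by linarith
  ultimately show "positive_density w"
    using wi unfolding positive_density_def value_density_def cdf_def cake_value_def
    by blast
qed

text \<open>Doubling the density on the first quarter raises the distribution function by
  \<open>L / 4\<close> on the second, which moves the balance point to the middle of that quarter;
  halving the density on the second half pays the mass back. The second quarter keeps density 1 and
  is the new window.\<close>

lemma window_left:
  assumes W: "window p L v"
  shows "\<exists>w. window (p + L / 4) (L / 4) w \<and> agree_outside p L v w"
proof -
  define w where "w = (\<lambda>x. v x + 1 * indicator {p<..<p+L/4} x
    + (-1/2) * indicator {p+L/2<..<p+L} x)"
  have L: "0 < L" "0 \<le> p" "p + L \<le> 1"
    and v: "\<And>x. x \<in> {p..p + L} \<Longrightarrow> v x = 1 \<and> cdf v x = 1 - 2 * p - L + x"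
    using W by (auto simp: window_def)
  note * = window_bumps[OF W, of p "p+L/4" "p+L/2" "p+L" 1 "-1/2", folded w_def]
  have "window (p + L / 4) (L / 4) w"
    unfolding window_def
  proof (intro conjI ballI)
    fix x assume x: "x \<in> {p + L/4..p + L/4 + L/4}"
    then show "w x = 1" using L v[of x] by (auto simp: w_def indicator_def)
    have "cdf w x = cdf v x + max 0 (min (p+L/4) x - p) - 1/2 * max 0 (min (p+L) x - (p + L/2))"
      using x L by (subst *(2)) auto
    then show "cdf w x = 1 - 2 * (p + L/4) - L/4 + x"
      using x L v[of x] by auto
  next
    show "positive_density w" using L by (intro *(1)) auto
  qed (use L in auto)
  moreover have "agree_outside p L v w" using L by (intro *(3)) auto
  ultimately show ?thesis by blast
qed

text \<open>Mirror image: halving on the first half lowers the distribution function by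
  \<open>L / 4\<close> on the third quarter, the new window, and doubling on the last quarter
  restores the mass.\<close>

lemma window_right:
  assumes W: "window p L v"
  shows "\<exists>w. window (p + L / 2) (L / 4) w \<and> agree_outside p L v w"
proof -
  define w where "w = (\<lambda>x. v x + (-1/2) * indicator {p<..<p+L/2} x
    + 1 * indicator {p+3*L/4<..<p+L} x)"
  have L: "0 < L" "0 \<le> p" "p + L \<le> 1"
    and v: "\<And>x. x \<in> {p..p + L} \<Longrightarrow> v x = 1 \<and> cdf v x = 1 - 2 * p - L + x"
    using W by (auto simp: window_def)
  note * = window_bumps[OF W, of p "p+L/2" "p+3*L/4" "p+L" "-1/2" 1, folded w_def]
  have "window (p + L / 2) (L / 4) w"
    unfolding window_def
  proof (intro conjI ballI)
    fix x assume x: "x \<in> {p + L/2..p + L/2 + L/4}"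
    then show "w x = 1" using L v[of x] by (auto simp: w_def indicator_def)
    have "cdf w x = cdf v x - 1/2 * max 0 (min (p+L/2) x - p) + max 0 (min (p+L) x - (p + 3*L/4))"
      using x L by (subst *(2)) auto
    then show "cdf w x = 1 - 2 * (p + L/2) - L/4 + x"
      using x L v[of x] by auto
  next
    show "positive_density w" using L by (intro *(1)) auto
  qed (use L in auto)
  moreover have "agree_outside p L v w" using L by (intro *(3)) auto
  ultimately show ?thesis by blast
qed

text \<open>The two available windows are the open second and third quarters. They are disjoint, so
  one of them misses \<open>\<alpha>\<close>.\<close>

lemma window_avoid:
  assumes "window p L v"
  obtains p' w where "window p' (L / 4) w" "p \<le> p'" "p' + L / 4 \<le> p + L"
    "agree_outside p L v w" "\<alpha> \<notin> {p'<..<p' + L / 4}"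
proof (cases "p + L / 2 \<le> \<alpha>")
  case True
  with window_left[OF assms] that[of "p + L / 4"] assms show ?thesis
    by (auto simp: window_def)
next
  case False
  with window_right[OF assms] that[of "p + L / 2"] assms show ?thesis
    by (auto simp: window_def)
qed

section \<open>Answering one query\<close>

lemma agree_outside_trans:
  assumes "agree_outside p L v w" "agree_outside p' L' w u" "p \<le> p'" "p' + L' \<le> p + L"
  shows "agree_outside p L v u"
  using assms by (auto simp: agree_outside_def)

text \<open>The density \<open>w\<close> is only a witness: every positive density that agrees with
  it outside the new window gives the same answer \<open>y\<close>, so the answer is committed while
  the inside of the window stays open.\<close>

lemma window_answer:
  assumes "cut_rule \<rho>" and W: "window p L v" and q: "legal_query 2 h q"
    and h: "cut_points h \<subseteq> {0..1} - {p<..<p + L}"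
  obtains p' L' w y where "window p' L' w" "L / 4 \<le> L'" "p \<le> p'" "p' + L' \<le> p + L"
    "agree_outside p L v w" "cut_points (h @ [(q, y)]) \<subseteq> {0..1} - {p'<..<p' + L'}"
    "\<And>u. positive_density u \<Longrightarrow> agree_outside p' L' w u \<Longrightarrow> answer \<rho> (profile u) q = y"
proof (cases q)
  case (Eval i y)
  have L: "0 < L" using W by (simp add: window_def)
  from q Eval have i: "i = 1 \<or> i = 2" and y: "y \<in> cut_points h" by auto
  \<comment> \<open>An evaluation concerns an existing cut point, which lies outside the window. Its
    answer is already fixed, and the window is kept unchanged.\<close>
  have "answer \<rho> (profile u) q = (if i = 1 then y else cdf v y)"
    if "agree_outside p L v u" for u
    using i that y h by (auto simp: Eval profile_def agree_outside_def cdf_def[symmetric] cdf_uniform)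
  moreover have "cut_points (h @ [(q, z)]) = cut_points h" for z
    by (auto simp: cut_points_def Eval)
  ultimately show ?thesis
    using that[of p L v] W h L by (auto simp: agree_outside_def)
next
  case (Cut i \<alpha>)
  from q Cut have i: "i = 1 \<or> i = 2" and \<alpha>: "\<alpha> \<in> {0..1}" by auto
  \<comment> \<open>The window is \<open>(p, p + L)\<close> in player 1's values and \<open>(1 - p - L, 1 - p)\<close> in player 2's.\<close>
  define l where "l = (if i = 1 then \<alpha> else 1 - \<alpha>)"
  obtain p' w where w: "window p' (L / 4) w" "p \<le> p'" "p' + L / 4 \<le> p + L"
    "agree_outside p L v w" and l: "l \<notin> {p'<..<p' + L / 4}"
    using window_avoid[OF W] by blast
  define y where "y = \<rho> i (profile w i) \<alpha>"
  have wd: "positive_density w"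
    and wc: "\<And>x. x \<in> {p'..p' + L/4} \<Longrightarrow> cdf w x = 1 - 2 * p' - L/4 + x"
    using w(1) by (auto simp: window_def)
  have pd: "positive_density (profile u i)" if "positive_density u" for u
    using that positive_density_uniform by (simp add: profile_def)
  have y: "y \<in> {0..1}" "cdf (profile w i) y = \<alpha>"
    using assms(1) pd[OF wd] \<alpha> by (auto simp: cut_rule_def positive_density_def cdf_def y_def)
  have out: "y \<notin> {p'<..<p' + L/4}"
  proof
    assume yin: "y \<in> {p'<..<p' + L/4}"
    show False
    proof (cases "i = 1")
      case True
      with y l yin show ?thesis by (auto simp: profile_def l_def cdf_uniform)
    next
      case False
      \<comment> \<open>Inside the window \<open>1 - \<alpha>\<close> equals
        \<open>2 * p' + L / 4 - y\<close>, the reflection of \<open>y\<close> in the midpoint, so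
        \<open>l\<close> would lie in the window as well.\<close>
      with y wc[of y] l yin show ?thesis by (auto simp: profile_def l_def)
    qed
  qed
  have "answer \<rho> (profile u) q = y" if "positive_density u" "agree_outside p' (L/4) w u" for u
  proof -
    \<comment> \<open>As \<open>y\<close> is outside the new window, \<open>u\<close> inherits the
      value \<open>\<alpha>\<close> at \<open>y\<close>, and injectivity makes \<open>y\<close> the
      only possible answer.\<close>
    have "cdf (profile u i) y = \<alpha>"
      using y out that(2) by (auto simp: profile_def agree_outside_def split: if_splits)
    then show ?thesis
      using cut_rule_eqI[OF assms(1) pd[OF that(1)] y(1) \<alpha>] by (simp add: Cut)
  qed
  moreover have "cut_points (h @ [(q, y)]) = insert y (cut_points h)"
    by (auto simp: cut_points_def Cut)
  moreover have "insert y (cut_points h) \<subseteq> {0..1} - {p'<..<p' + L / 4}"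
    using h w(2,3) y(1) out by auto
  ultimately show ?thesis
    using that[OF w(1) order_refl w(2,3,4), of y] by simp
qed

section \<open>From connected allocations to single cuts\<close>

lemma cake_value_spike:
  assumes v: "set_integrable lebesgue S v" and fin: "finite (S - T)" "finite (T - S)"
  shows "cake_value v T = cake_value v S"
proof -
  have n: "negligible {x \<in> S - T. v x \<noteq> 0}" "negligible {x \<in> T - S. v x \<noteq> 0}"
    using fin 
    by (auto intro!: negligible_finite elim: rev_finite_subset)
  then have "set_integrable lebesgue T v"
    using v absolutely_integrable_spike_set_eq[of S T v] by simp
  moreover have "integral S v = integral T v"
    using n by (rule integral_spike_set)
  ultimately show ?thesis
    using v by (simp add: cake_value_eq_integral)
qed

text \<open>The cut is \<open>Sup S\<close>: points of the cake below it belong to \<open>S\<close>,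
  points above it to \<open>T\<close>, and whatever \<open>T\<close> has below it lies in the finite
  overlap.\<close>

lemma interval_split:
  fixes S T :: "real set"
  assumes S: "is_interval S" "0 \<in> S" and U: "S \<union> T = {0..1}" and fin: "finite (S \<inter> T)"
  obtains x where "x \<in> frontier S \<union> {1}" "x \<in> {0..1}"
    "finite (S - {0..x})" "finite ({0..x} - S)" "finite (T - {x..1})" "finite ({x..1} - T)"
proof -
  define b where "b = Sup S"
  have bdd: "bdd_above S" using U by (auto intro!: bdd_aboveI[of _ 1])
  have le: "x \<le> b" if "x \<in> S" for x unfolding b_def using that bdd by (rule cSup_upper)
  have b1: "b \<le> 1" unfolding b_def using S(2) U by (intro cSup_least) auto
  have b0: "0 \<le> b" using le S(2) .
  have mem: "x \<in> S" if "0 \<le> x" and "x < b" for x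
  proof -
    obtain z where "z \<in> S" "x < z"
      using less_cSupD[of S x] S(2) \<open>x < b\<close> by (auto simp: b_def)
    with S that show ?thesis unfolding is_interval_1 by (meson less_imp_le)
  qed
  have notin: "x \<in> T" if "b < x" "x \<le> 1" for x
    using that U le[of x] b0 by force
  have "b \<in> frontier S \<union> {1}"
  proof (cases "b = 1")
    case False
    have "b \<in> closure S" unfolding b_def using S(2) bdd by (intro closure_contains_Sup) auto
    moreover have "b \<notin> interior S"
    proof
      assume "b \<in> interior S"
      then obtain e where "e > 0" "cball b e \<subseteq> S" by (auto simp: mem_interior_cball)
      then have "b + e \<in> S" by (auto simp: dist_real_def)
      with le \<open>e > 0\<close> show False by fastforce
    qed
    ultimately show ?thesis by (simp add: frontier_def)
  qed simp
  moreover have "S - {0..b} \<subseteq> {}" using le U by auto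
  moreover have "{0..b} - S \<subseteq> {b}" using mem by force
  moreover have "T - {b..1} \<subseteq> S \<inter> T" using mem U by force
  moreover have "{b..1} - T \<subseteq> {b}" using notin by force
  moreover have "b \<in> {0..1}" using b0 b1 by simp
  ultimately show thesis
    using that[of b] fin by (meson finite.emptyI finite.insertI finite_subset)
qed

text \<open>For a cut at \<open>x\<close> the left player gets the own distribution function at
  \<open>x\<close>, the right player 1 minus the own one. The difference is the sum of both minus 1,
  which is symmetric in the players, so both orders of the pieces give the same condition.\<close>

lemma output_near_balance:
  assumes v: "positive_density v" and A: "connected_allocation 2 A"
    and E: "equitable \<epsilon> 2 (profile v) A" and fr: "\<forall>i\<in>{1..2}. frontier (A i) \<subseteq> C"
  shows "\<exists>x\<in>(C \<union> {1}) \<inter> {0..1}. \<bar>x + cdf v x - 1\<bar> \<le> \<epsilon>"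
proof -
  have two: "{1..2::nat} = {1, 2}" by auto
  have U: "A 1 \<union> A 2 = {0..1}" and I: "is_interval (A 1)" "is_interval (A 2)"
    and F: "finite (A 1 \<inter> A 2)"
    using A unfolding connected_allocation_def allocation_def two by auto
  have split: "\<exists>x\<in>(C \<union> {1}) \<inter> {0..1}. \<bar>x + cdf v x - 1\<bar> \<le> \<epsilon>"
    if "0 \<in> A i" and ij: "(i, j) = (1, 2) \<or> (i, j) = (2, 1)" for i j :: nat
  proof -
    have "A i \<union> A j = {0..1}" "is_interval (A i)" "finite (A i \<inter> A j)"
      using U I F ij by (auto simp: Un_commute Int_commute)
    then obtain x where x: "x \<in> frontier (A i) \<union> {1}" "x \<in> {0..1}"
      "finite (A i - {0..x})" "finite ({0..x} - A i)" "finite (A j - {x..1})" "finite ({x..1} - A j)"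
      using interval_split[of "A i" "A j"] \<open>0 \<in> A i\<close> by metis
    have d: "value_density (profile v k)" for k
      using v positive_density_uniform by (auto simp: profile_def positive_density_def)
    have "cake_value (profile v i) (A i) = cake_value (profile v i) {0..x}"
      using x by (intro cake_value_spike value_density_integrable d) auto
    moreover have "cake_value (profile v j) (A j) = cake_value (profile v j) {x..1}"
      using x by (intro cake_value_spike value_density_integrable d) auto
    moreover have "cake_value (profile v j) {x..1} = 1 - cdf (profile v j) x"
      using x by (simp add: cake_value_interval[OF d] cdf_bounds[OF d])
    moreover have "\<bar>cake_value (profile v i) (A i) - cake_value (profile v j) (A j)\<bar> \<le> \<epsilon>"
      using E ij by (auto simp: equitable_def)
    ultimately have "\<bar>cdf (profile v i) x + cdf (profile v j) x - 1\<bar> \<le> \<epsilon>"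
      by (simp add: cdf_def)
    moreover have "cdf (profile v i) x + cdf (profile v j) x = x + cdf v x"
      using ij x(2) by (auto simp: profile_def cdf_uniform)
    moreover have "x \<in> C \<union> {1}" using x(1) fr ij by auto
    ultimately show ?thesis using x(2) by auto
  qed
  have "0 \<in> A 1 \<or> 0 \<in> A 2" using U by auto
  with split[of 1 2] split[of 2 1] show ?thesis by auto
qed

text \<open>The function \<open>x + cdf v x\<close> is increasing and equals \<open>1 - L\<close> at
  \<open>p\<close> and \<open>1 + L\<close> at \<open>p + L\<close>.\<close>

lemma window_imbalance:
  assumes "window p L v" "x \<in> {0..1} - {p<..<p + L}"
  shows "L \<le> \<bar>x + cdf v x - 1\<bar>"
proof -
  have v: "positive_density v" and p: "0 \<le> p" "0 < L" "p + L \<le> 1"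
    and e: "cdf v p = 1 - p - L" "cdf v (p + L) = 1 - p"
    using assms(1) by (auto simp: window_def)
  have mono: "cdf v a \<le> cdf v b" if "0 \<le> a" "a \<le> b" "b \<le> 1" for a b
    using cdf_strict_mono[OF v, of a b] that by (cases "a = b") auto
  from assms(2) consider "x \<le> p" "0 \<le> x" | "p + L \<le> x" "x \<le> 1" by fastforce
  then show ?thesis
    by cases (use mono[of x p] mono[of "p + L" x] p e in auto)
qed

section \<open>The adversary and the lower bound\<close>

text \<open>The last conjunct carries the induction: all positive densities agreeing with
  \<open>v\<close> outside the window share the transcript \<open>h\<close>. The length is
  \<open>Suc k\<close> because a window of length at least \<open>(1 / 4) ^ k\<close>, still above
  \<open>\<epsilon>\<close>, forces one more query.\<close>

lemma adversary:
  assumes \<rho>: "cut_rule \<rho>" and P: "computes_connected_equitable \<epsilon> 2 \<rho> P"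
    and k: "\<epsilon> < (1 / 4) ^ k"
  shows "\<exists>h p L v. length h = Suc k \<and> window p L v \<and> (1 / 4) ^ Suc k \<le> L \<and>
    cut_points h \<subseteq> {0..1} - {p<..<p + L} \<and>
    (\<forall>u. positive_density u \<longrightarrow> agree_outside p L v u \<longrightarrow> run 2 \<rho> P (profile u) h)"
proof -
  have step: "\<exists>h p L v. length h = Suc m \<and> window p L v \<and> (1 / 4) ^ Suc m \<le> L \<and>
      cut_points h \<subseteq> {0..1} - {p<..<p + L} \<and>
      (\<forall>u. positive_density u \<longrightarrow> agree_outside p L v u \<longrightarrow> run 2 \<rho> P (profile u) h)"
    if m: "\<epsilon> < (1 / 4) ^ m" "length h = m" "(1 / 4) ^ m \<le> L" and W: "window p L v"
      and h: "cut_points h \<subseteq> {0..1} - {p<..<p + L}"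
      and run: "\<And>u. positive_density u \<Longrightarrow> agree_outside p L v u \<Longrightarrow> run 2 \<rho> P (profile u) h"
    for m h p L v
  proof -
    have pd: "positive_density v" and L: "0 \<le> p" "0 < L" "p + L \<le> 1"
      using W by (auto simp: window_def)
    have rv: "run 2 \<rho> P (profile v) h"
      using run[OF pd] by (simp add: agree_outside_def)
    obtain h' A where h': "outputs 2 \<rho> P (profile v) h' A" "connected_allocation 2 A"
      "equitable \<epsilon> 2 (profile v) A"
      using P cake_instance_profile[OF pd] by (auto simp: computes_connected_equitable_def)
    then have r': "run 2 \<rho> P (profile v) h'" "P h' = Return A"
      by (auto simp: outputs_def)
    from rv r' obtain q where q: "P h = Ask q" "legal_query 2 h q"
    proof (cases rule: run_next)
      case 1
      \<comment> \<open>Stopping at \<open>h\<close> is impossible: the cut points and the ends 0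
        and 1 all lie outside the open window, so every available cut is off balance by at least
        \<open>L\<close>, which exceeds \<open>\<epsilon>\<close>.\<close>
      have fr: "\<forall>i\<in>{1..2}. frontier (A i) \<subseteq> cut_points h \<union> {0, 1}"
        using h'(1) 1 by (auto simp: outputs_def)
      obtain x where "x \<in> (cut_points h \<union> {0, 1} \<union> {1}) \<inter> {0..1}" "\<bar>x + cdf v x - 1\<bar> \<le> \<epsilon>"
        using output_near_balance[OF pd h'(2,3) fr] by blast
      moreover from this have "x \<in> {0..1} - {p<..<p + L}" using h L by auto
      ultimately have "L \<le> \<epsilon>" using window_imbalance[OF W, of x] by linarith
      with m(1,3) show ?thesis by linarith
    qed (use that in blast)
    obtain p' L' w y where w: "window p' L' w" "L / 4 \<le> L'" "p \<le> p'" "p' + L' \<le> p + L"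
      "agree_outside p L v w" "cut_points (h @ [(q, y)]) \<subseteq> {0..1} - {p'<..<p' + L'}"
      "\<And>u. positive_density u \<Longrightarrow> agree_outside p' L' w u \<Longrightarrow> answer \<rho> (profile u) q = y"
      using window_answer[OF \<rho> W q(2) h] by blast
    \<comment> \<open>Agreement with \<open>w\<close> outside the smaller window implies agreement
      with \<open>v\<close> outside the larger one, so the run on \<open>u\<close> reaches
      \<open>h\<close> and then receives \<open>y\<close>.\<close>
    have "run 2 \<rho> P (profile u) (h @ [(q, y)])"
      if u: "positive_density u" "agree_outside p' L' w u" for u
      using run.ask[OF run[OF u(1) agree_outside_trans[OF w(5) u(2) w(3,4)]] q]
      by (simp add: w(7)[OF u])
    then show ?thesis
      using w(1,2,6) m(2,3)
      by (intro exI[of _ "h @ [(q, y)]"] exI[of _ p'] exI[of _ L'] exI[of _ w]) auto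
  qed
  show ?thesis
    using k
  proof (induction k)
    case 0
    \<comment> \<open>Initially both players are uniform and the window is the whole open
      cake.\<close>
    have "window 0 1 (\<lambda>_. 1)"
      by (auto simp: window_def positive_density_uniform cdf_uniform)
    then show ?case
      by (intro step[of 0 "[]" 1 0 "\<lambda>_. 1"]) (use 0 in \<open>auto simp: cut_points_def run.start\<close>)
  next
    case (Suc k)
    have "\<epsilon> < (1 / 4) ^ k"
      using Suc.prems by (rule less_le_trans) simp
    from Suc.IH[OF this] obtain h p L v where "length h = Suc k"
      "(1 / 4) ^ Suc k \<le> L" "window p L v" "cut_points h \<subseteq> {0..1} - {p<..<p + L}"
      "\<And>u. positive_density u \<Longrightarrow> agree_outside p L v u \<Longrightarrow> run 2 \<rho> P (profile u) h"
      by blast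
    from step[OF Suc.prems this] show ?case .
  qed
qed

theorem theorem6p2:
  "\<exists>c \<epsilon>\<^sub>0 :: real. c > 0 \<and> 0 < \<epsilon>\<^sub>0 \<and> \<epsilon>\<^sub>0 < 1 \<and>
     (\<forall>\<epsilon> \<rho> P. 0 < \<epsilon> \<longrightarrow> \<epsilon> < \<epsilon>\<^sub>0 \<longrightarrow> cut_rule \<rho> \<longrightarrow> computes_connected_equitable \<epsilon> 2 \<rho> P \<longrightarrow>
       (\<exists>v h A. cake_instance 2 v \<and> outputs 2 \<rho> P v h A \<and> real (length h) \<ge> c * ln (1 / \<epsilon>)))"
proof (rule exI[of _ "1 / ln 4"], rule exI[of _ "1 / 2"], intro conjI allI impI)
  fix \<epsilon> :: real and \<rho> P
  assume \<epsilon>: "0 < \<epsilon>" "\<epsilon> < 1 / 2" and \<rho>: "cut_rule \<rho>"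
    and P: "computes_connected_equitable \<epsilon> 2 \<rho> P"
  \<comment> \<open>Minimality gives \<open>\<epsilon> < (1 / 4) ^ (m - 1)\<close>, hence
    \<open>m\<close> forced queries, while \<open>1 / \<epsilon> \<le> 4 ^ m\<close> bounds
    \<open>m\<close> from below; the constant \<open>1 / ln 4\<close> reflects the shrinking factor
    4.\<close>
  define m where "m = (LEAST m. (1 / 4) ^ m \<le> \<epsilon>)"
  have ex: "\<exists>m. (1 / 4) ^ m \<le> \<epsilon>"
    using real_arch_pow_inv[of \<epsilon> "1 / 4"] \<epsilon> by (auto intro: less_imp_le)
  have m: "(1 / 4) ^ m \<le> \<epsilon>"
    unfolding m_def using ex by (rule LeastI_ex)
  \<comment> \<open>The bound on \<open>\<epsilon>\<close> keeps it below 1, the value of the power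
    at \<open>m = 0\<close>.\<close>
  then have "m \<noteq> 0" using \<epsilon> by (intro notI) simp
  then obtain k where mk: "m = Suc k" by (cases m) auto
  have "\<epsilon> < (1 / 4) ^ k"
    using not_less_Least[of k "\<lambda>m. (1 / 4) ^ m \<le> \<epsilon>"] mk by (simp add: m_def)
  from adversary[OF \<rho> P this] obtain h p L v where len: "length h = m" and W: "window p L v"
    and run: "\<And>u. positive_density u \<Longrightarrow> agree_outside p L v u \<Longrightarrow> run 2 \<rho> P (profile u) h"
    unfolding mk by blast
  have pd: "positive_density v" using W by (simp add: window_def)
  then have r: "run 2 \<rho> P (profile v) h" by (intro run) (auto simp: agree_outside_def)
  obtain h' A where h': "outputs 2 \<rho> P (profile v) h' A"
    using P cake_instance_profile[OF pd] by (auto simp: computes_connected_equitable_def)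
  \<comment> \<open>By correctness the protocol also halts on this instance, and its final
    transcript must extend the forced one.\<close>
  then have "\<exists>t. h' = h @ t"
    by (intro run_extends[OF r, of h' A]) (simp_all add: outputs_def)
  then obtain t where t: "h' = h @ t" ..
  have "ln (1 / \<epsilon>) \<le> ln (4 ^ m)"
    using m \<epsilon> by (simp add: field_simps power_divide)
  also have "\<dots> = m * ln 4" by (simp add: ln_realpow)
  finally have "1 / ln 4 * ln (1 / \<epsilon>) \<le> m" by (simp add: field_simps)
  also have "\<dots> \<le> length h'" using len t by simp
  finally show "\<exists>v h A. cake_instance 2 v \<and> outputs 2 \<rho> P v h A \<and> 1 / ln 4 * ln (1 / \<epsilon>) \<le> real (length h)"
    using h' cake_instance_profile[OF pd] by blast
qed auto

end
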